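(* Let $\mathcal{U}$ be a distribution over the set of finite partitions of $\mathcal{X}$, let $q\ge 1$ be an integer and $x\in\mathcal{X}$. Let $\mathbb{V}_q=(\mathbb{U}^1,\dots,\mathbb{U}^q)$, where $\mathbb{U}^1,\dots,\mathbb{U}^q$ are independent random partitions with common distribution $\mathcal{U}$. Then $$\mathbb{E}\Big[\big(s(x)-\tilde s_{\mathbb{V}_q}(x)\big)^2\Big]=\Big(s(x)-\mathbb{E}_{\mathbb{U}\sim\mathcal{U}}\big[\tilde s_{\mathbb{U}}(x)\big]\Big)^2+\frac{\operatorname{var}_{\mathbb{U}\sim\mathcal{U}}\big(\tilde s_{\mathbb{U}}(x)\big)}{q}.$$
   Context: $\mathcal{X}$ is a measurable set, $s:\mathcal{X}\to\mathbb{R}$ a measurable function, and $X$ an $\mathcal{X}$-valued random variable. For a finite partition $\mathbb{U}$ of $\mathcal{X}$ and $\lambda\in\mathbb{U}$ with $\mathbb{P}(X\in\lambda)>0$ set $\beta_\lambda=\mathbb{E}[s(X)\mid X\in\lambda]$, and $\tilde s_{\mathbb{U}}=\sum_{\lambda\in\mathbb{U}}\beta_\lambda\mathbf{1}_\lambda$. For a finite sequence $\mathbb{V}_q=(\mathbb{U}^j)_{1\le j\le q}$ of partitions, $\tilde s_{\mathbb{V}_q}=\frac1q\sum_{j=1}^q\tilde s_{\mathbb{U}^j}$. It is understood that, for $\mathbb{U}\sim\mathcal{U}$, $\tilde s_{\mathbb{U}}(x)$ is almost surely well-defined and is a square-integrable random variable. *)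

theory Defs
  imports "HOL-Probability.Probability"
begin

text \<open>Cells are required to be measurable, so that the event \<open>X \<in> A\<close> has a probability.\<close>

definition finite_partitions :: "'x measure \<Rightarrow> 'x set set set" where
  "finite_partitions S = {U. partition_on (space S) U \<and> finite U \<and> U \<subseteq> sets S}"

text \<open>
  \<open>uniform_measure P B\<close> is the conditional probability measure \<open>P(\<cdot> | B)\<close>, so
  \<open>cell_mean P X s A\<close> is \<open>\<beta>\<^sub>A = E[s(X) | X \<in> A]\<close>. It is meaningful only under
  \<open>cell_mean_defined\<close>; otherwise it is an arbitrary total extension.
\<close>

definition cell_law :: "'w measure \<Rightarrow> ('w \<Rightarrow> 'x) \<Rightarrow> 'x set \<Rightarrow> 'w measure" where
  "cell_law P X A = uniform_measure P {\<omega> \<in> space P. X \<omega> \<in> A}"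

definition cell_mean :: "'w measure \<Rightarrow> ('w \<Rightarrow> 'x) \<Rightarrow> ('x \<Rightarrow> real) \<Rightarrow> 'x set \<Rightarrow> real" where
  "cell_mean P X s A = (\<integral>\<omega>. s (X \<omega>) \<partial>cell_law P X A)"

definition cell_mean_defined ::
  "'w measure \<Rightarrow> ('w \<Rightarrow> 'x) \<Rightarrow> ('x \<Rightarrow> real) \<Rightarrow> 'x set \<Rightarrow> bool" where
  "cell_mean_defined P X s A \<longleftrightarrow>
     measure P {\<omega> \<in> space P. X \<omega> \<in> A} > 0 \<and>
     integrable (cell_law P X A) (\<lambda>\<omega>. s (X \<omega>))"

definition s_tilde ::
  "'w measure \<Rightarrow> ('w \<Rightarrow> 'x) \<Rightarrow> ('x \<Rightarrow> real) \<Rightarrow> 'x set set \<Rightarrow> 'x \<Rightarrow> real" where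
  "s_tilde P X s U x = (\<Sum>A\<in>U. cell_mean P X s A * indicator A x)"

text \<open>Only the cell containing \<open>x\<close> contributes to the value at \<open>x\<close>.\<close>

definition s_tilde_defined ::
  "'w measure \<Rightarrow> ('w \<Rightarrow> 'x) \<Rightarrow> ('x \<Rightarrow> real) \<Rightarrow> 'x set set \<Rightarrow> 'x \<Rightarrow> bool" where
  "s_tilde_defined P X s U x \<longleftrightarrow> (\<forall>A\<in>U. x \<in> A \<longrightarrow> cell_mean_defined P X s A)"

text \<open>A sequence of \<open>q\<close> partitions is a function of which only the values on \<open>{1..q}\<close> matter.\<close>

definition s_tilde_seq ::
  "'w measure \<Rightarrow> ('w \<Rightarrow> 'x) \<Rightarrow> ('x \<Rightarrow> real) \<Rightarrow> nat \<Rightarrow> (nat \<Rightarrow> 'x set set) \<Rightarrow> 'x \<Rightarrow> real" where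
  "s_tilde_seq P X s q V x = (1 / real q) * (\<Sum>j=1..q. s_tilde P X s (V j) x)"

end

theory Submission
  imports Defs
begin

text \<open>
  The identity is the bias-variance decomposition of a sample mean. Evaluation at \<open>x\<close> turns the
  independent random partitions into independent real random variables \<open>Y\<^sub>j\<close>, the values at \<open>x\<close> of
  the estimators built on them, all with the mean \<open>m\<close> and the variance \<open>v\<close> of \<open>s_tilde P X s U x\<close>
  under \<open>\<U>\<close>. With \<open>D\<^sub>j = Y\<^sub>j - m\<close> and \<open>n\<close> variables, the error is \<open>(s x - m) - (1 / n) * (\<Sum>j. D\<^sub>j)\<close>.
  When its square is expanded, the cross term vanishes because the \<open>D\<^sub>j\<close> are centred, and the
  second moment of \<open>\<Sum>j. D\<^sub>j\<close> is \<open>n * v\<close>, since independent centred variables are orthogonal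
  (lemma \<open>expectation_square_sum_centred\<close>). Lemma \<open>sample_mean_bias_variance\<close> carries this out for
  real random variables; what then remains is to transport moments from \<open>\<U>\<close> to the \<open>Y\<^sub>j\<close> along
  the laws of the partitions.
\<close>

lemma (in prob_space) expectation_square_sum_centred:
  fixes D :: "'i \<Rightarrow> 'a \<Rightarrow> real"
  assumes "finite I"
    and "indep_vars (\<lambda>_. borel) D I"
    and "\<And>i. i \<in> I \<Longrightarrow> integrable M (\<lambda>\<omega>. (D i \<omega>)\<^sup>2)"
    and "\<And>i. i \<in> I \<Longrightarrow> expectation (D i) = 0"
  shows "integrable M (\<lambda>\<omega>. (\<Sum>i\<in>I. D i \<omega>)\<^sup>2)"
    and "expectation (\<lambda>\<omega>. (\<Sum>i\<in>I. D i \<omega>)\<^sup>2) = (\<Sum>i\<in>I. expectation (\<lambda>\<omega>. (D i \<omega>)\<^sup>2))"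
proof -
  have "integrable M (\<lambda>\<omega>. (\<Sum>i\<in>I. D i \<omega>)\<^sup>2) \<and>
    expectation (\<lambda>\<omega>. (\<Sum>i\<in>I. D i \<omega>)\<^sup>2) = (\<Sum>i\<in>I. expectation (\<lambda>\<omega>. (D i \<omega>)\<^sup>2))"
    using assms
  proof (induction I rule: finite_induct)
    case empty
    show ?case by simp
  next
    case (insert i I)
    let ?S = "\<lambda>\<omega>. \<Sum>j\<in>I. D j \<omega>"
    have "indep_vars (\<lambda>_. borel) D I"
      using insert.prems(1) by (rule indep_vars_subset) auto
    then have IH: "integrable M (\<lambda>\<omega>. (?S \<omega>)\<^sup>2)"
        "expectation (\<lambda>\<omega>. (?S \<omega>)\<^sup>2) = (\<Sum>j\<in>I. expectation (\<lambda>\<omega>. (D j \<omega>)\<^sup>2))"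
      using insert.IH insert.prems by auto
    have int: "integrable M (D j)" if "j \<in> insert i I" for j
    proof (rule square_integrable_imp_integrable)
      show "D j \<in> borel_measurable M"
        using insert.prems(1) that unfolding indep_vars_def by blast
    qed (fact insert.prems(2)[OF that])
    then have intS: "integrable M ?S"
      by (intro Bochner_Integration.integrable_sum) auto
    have ind: "indep_var borel (D i) borel ?S"
      using insert by (intro indep_vars_sum) auto
    \<comment> \<open>By independence the cross term factors into a product of means.\<close>
    have int_mult: "integrable M (\<lambda>\<omega>. D i \<omega> * ?S \<omega>)"
      using indep_var_integrable[OF ind] int intS by auto
    have mult: "expectation (\<lambda>\<omega>. D i \<omega> * ?S \<omega>) = 0"
      using indep_var_lebesgue_integral[OF ind] int intS insert.prems(3) by auto
    have eq: "(\<Sum>j\<in>insert i I. D j \<omega>)\<^sup>2 = (D i \<omega>)\<^sup>2 + (?S \<omega>)\<^sup>2 + 2 * (D i \<omega> * ?S \<omega>)" for \<omega>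
      using insert.hyps by (simp add: power2_sum)
    show ?case
      unfolding eq using IH int_mult mult insert.hyps insert.prems(2) by simp
  qed
  then show "integrable M (\<lambda>\<omega>. (\<Sum>i\<in>I. D i \<omega>)\<^sup>2)"
    and "expectation (\<lambda>\<omega>. (\<Sum>i\<in>I. D i \<omega>)\<^sup>2) = (\<Sum>i\<in>I. expectation (\<lambda>\<omega>. (D i \<omega>)\<^sup>2))"
    by auto
qed

lemma (in prob_space) sample_mean_bias_variance:
  fixes Y :: "'i \<Rightarrow> 'a \<Rightarrow> real"
  assumes I: "finite I" "I \<noteq> {}"
    and indep: "indep_vars (\<lambda>_. borel) Y I"
    and sq: "\<And>i. i \<in> I \<Longrightarrow> integrable M (\<lambda>\<omega>. (Y i \<omega>)\<^sup>2)"
    and mean: "\<And>i. i \<in> I \<Longrightarrow> expectation (Y i) = m"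
    and var: "\<And>i. i \<in> I \<Longrightarrow> variance (Y i) = v"
  shows "expectation (\<lambda>\<omega>. (a - 1 / real (card I) * (\<Sum>i\<in>I. Y i \<omega>))\<^sup>2) =
    (a - m)\<^sup>2 + v / real (card I)"
proof -
  let ?n = "real (card I)"
  let ?D = "\<lambda>i \<omega>. Y i \<omega> - m"
  let ?S = "\<lambda>\<omega>. \<Sum>i\<in>I. ?D i \<omega>"
  have n: "?n > 0"
    using I by (simp add: card_gt_0_iff)
  have int: "integrable M (Y i)" if "i \<in> I" for i
  proof (rule square_integrable_imp_integrable)
    show "Y i \<in> borel_measurable M"
      using indep that unfolding indep_vars_def by blast
  qed (fact sq[OF that])
  have D_indep: "indep_vars (\<lambda>_. borel) ?D I"
    using indep by (rule indep_vars_compose2) simp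
  have D_sq: "integrable M (\<lambda>\<omega>. (?D i \<omega>)\<^sup>2)" if "i \<in> I" for i
    using that int sq by (simp add: power2_diff)
  have D_mean: "expectation (?D i) = 0" if "i \<in> I" for i
    using that int mean by (simp add: prob_space)
  note D = I(1) D_indep D_sq D_mean
  have S_sq: "integrable M (\<lambda>\<omega>. (?S \<omega>)\<^sup>2)"
    by (rule expectation_square_sum_centred(1)) (fact D)+
  have "expectation (\<lambda>\<omega>. (?S \<omega>)\<^sup>2) = (\<Sum>i\<in>I. expectation (\<lambda>\<omega>. (?D i \<omega>)\<^sup>2))"
    by (rule expectation_square_sum_centred(2)) (fact D)+
  also have "\<dots> = ?n * v"
    using mean var by simp
  finally have S_var: "expectation (\<lambda>\<omega>. (?S \<omega>)\<^sup>2) = ?n * v" .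
  have S_int: "integrable M ?S"
    using int by (intro Bochner_Integration.integrable_sum) simp
  have S_mean: "expectation ?S = 0"
    using int D_mean by (subst Bochner_Integration.integral_sum) auto
  have "(a - 1 / ?n * (\<Sum>i\<in>I. Y i \<omega>))\<^sup>2 =
      (a - m)\<^sup>2 - 2 * (a - m) / ?n * ?S \<omega> + (1 / ?n\<^sup>2) * (?S \<omega>)\<^sup>2" for \<omega>
  proof -
    have "a - 1 / ?n * (\<Sum>i\<in>I. Y i \<omega>) = (a - m) - 1 / ?n * ?S \<omega>"
      using n by (simp add: sum_subtractf field_simps)
    then show ?thesis
      by (simp only: power2_diff) (simp add: power_divide)
  qed
  then have "expectation (\<lambda>\<omega>. (a - 1 / ?n * (\<Sum>i\<in>I. Y i \<omega>))\<^sup>2) =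
      expectation (\<lambda>\<omega>. (a - m)\<^sup>2 - 2 * (a - m) / ?n * ?S \<omega> + (1 / ?n\<^sup>2) * (?S \<omega>)\<^sup>2)"
    by presburger
  also have "\<dots> = (a - m)\<^sup>2 - 2 * (a - m) / ?n * expectation ?S +
      (1 / ?n\<^sup>2) * expectation (\<lambda>\<omega>. (?S \<omega>)\<^sup>2)"
    using S_int S_sq
    by (simp add: prob_space)
  also have "\<dots> = (a - m)\<^sup>2 + v / ?n"
    unfolding S_mean S_var using n by (simp add: power2_eq_square)
  finally show ?thesis .
qed

theorem proposition1:
  fixes S :: "'x measure" and s :: "'x \<Rightarrow> real"
    and P :: "'w measure" and X :: "'w \<Rightarrow> 'x"
    and \<U> :: "'x set set measure"
    and Q :: "'v measure" and V :: "nat \<Rightarrow> 'v \<Rightarrow> 'x set set"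
    and q :: nat and x :: 'x
  assumes s: "s \<in> borel_measurable S"
    and P: "prob_space P"
    and X: "X \<in> P \<rightarrow>\<^sub>M S"
    and dist: "prob_space \<U>" "space \<U> = finite_partitions S"
    and q: "q \<ge> 1"
    and x: "x \<in> space S"
    and defined: "AE U in \<U>. s_tilde_defined P X s U x"
    and measurable: "(\<lambda>U. s_tilde P X s U x) \<in> borel_measurable \<U>"
    and square_integrable: "integrable \<U> (\<lambda>U. (s_tilde P X s U x)\<^sup>2)"
    and Q: "prob_space Q"
    and V_indep: "prob_space.indep_vars Q (\<lambda>_. \<U>) V {1..q}"
    and V_law: "\<And>j. j \<in> {1..q} \<Longrightarrow> distr Q \<U> (V j) = \<U>"
  shows "prob_space.expectation Q (\<lambda>\<omega>. (s x - s_tilde_seq P X s q (\<lambda>j. V j \<omega>) x)\<^sup>2) =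
           (s x - prob_space.expectation \<U> (\<lambda>U. s_tilde P X s U x))\<^sup>2 +
           prob_space.variance \<U> (\<lambda>U. s_tilde P X s U x) / real q"
proof -
  interpret Q: prob_space Q by fact
  let ?t = "\<lambda>U. s_tilde P X s U x"
  let ?m = "integral\<^sup>L \<U> ?t"
  have V_meas: "V j \<in> Q \<rightarrow>\<^sub>M \<U>" if "j \<in> {1..q}" for j
    using V_indep that by (auto simp: Q.indep_vars_def)
  have transfer: "(\<integral>\<omega>. f (V j \<omega>) \<partial>Q) = integral\<^sup>L \<U> f"
      if "j \<in> {1..q}" "f \<in> borel_measurable \<U>" for j and f :: "'x set set \<Rightarrow> real"
    using integral_distr[OF V_meas that(2)] that V_law by simp
  have "Q.indep_vars (\<lambda>_. borel) (\<lambda>j \<omega>. ?t (V j \<omega>)) {1..q}"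
    using V_indep measurable by (rule Q.indep_vars_compose2)
  moreover have "integrable Q (\<lambda>\<omega>. (?t (V j \<omega>))\<^sup>2)" if "j \<in> {1..q}" for j
    using that V_law square_integrable
    by (intro integrable_distr[OF V_meas, of j "\<lambda>U. (?t U)\<^sup>2"]) auto
  moreover have mean: "Q.expectation (\<lambda>\<omega>. ?t (V j \<omega>)) = ?m" if "j \<in> {1..q}" for j
    using that measurable by (rule transfer)
  moreover have "Q.variance (\<lambda>\<omega>. ?t (V j \<omega>)) = (\<integral>U. (?t U - ?m)\<^sup>2 \<partial>\<U>)" if "j \<in> {1..q}" for j
    unfolding mean[OF that] using measurable
    by (intro transfer that borel_measurable_power borel_measurable_diff borel_measurable_const)
  ultimately show ?thesis
    using Q.sample_mean_bias_variance[of "{1..q}" "\<lambda>j \<omega>. ?t (V j \<omega>)" ?m _ "s x"] q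
    unfolding s_tilde_seq_def by simp
qed

end
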